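(* Let $X \sim \mathrm{Bin}(3n, 1/2)$, and let $z_i$ be the (complex) roots of the probability generating function of $\lfloor 2X/3 \rfloor$. Then $$\max_i \{\Im(z_i)\} \ge \sqrt{\frac{9n^2 - 9n - 1}{2}},$$ where $\Im(z)$ is the imaginary part of $z$.
   Context: $\mathrm{Bin}(m,p)$ is the binomial distribution with $m$ trials and success probability $p$: $\mathbb{P}(X=k) = \binom{m}{k}p^k(1-p)^{m-k}$ for $0 \le k \le m$. $\lfloor x \rfloor$ is the integer part of $x$. For a random variable $W$ taking finitely many nonnegative integer values, its probability generating function is the polynomial $u \mapsto \mathbb{E}[u^W] = \sum_k \mathbb{P}(W=k)u^k$, $u \in \mathbb{C}$. *)

theory Defs
  imports "HOL-Probability.Probability"
begin

(* E[u^W] with the Bochner integral, which is 0 for non-integrable integrands; for W with finitely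
   many values it is the polynomial function u |-> sum_k P(W = k) u^k (where 0^0 = 1). *)
definition pgf :: "'a measure \<Rightarrow> ('a \<Rightarrow> nat) \<Rightarrow> complex \<Rightarrow> complex" where
  "pgf M W u = (LINT \<omega>|M. u ^ W \<omega>)"

end

theory Submission
  imports Defs "HOL-Computational_Algebra.Computational_Algebra"
begin

text \<open>Up to the factor \<open>8 ^ n\<close>, the generating function is a monic polynomial of degree \<open>2 * n\<close>
  whose next two coefficients are \<open>3 * n\<close> and \<open>(3 * n + 1) choose 3\<close>. Newton's identity therefore
  gives \<open>- n * (9 * n\<^sup>2 - 9 * n - 1)\<close> for the sum of the squares of its roots. As
  \<open>Re (z\<^sup>2) \<ge> - (Im z)\<^sup>2\<close>, one of the \<open>2 * n\<close> roots has \<open>(Im z)\<^sup>2\<close> at least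
  the average \<open>(9 * n\<^sup>2 - 9 * n - 1) / 2\<close>, and the roots are closed under conjugation.\<close>

definition floor_binom_poly :: "nat \<Rightarrow> complex poly" where
  "floor_binom_poly n = (\<Sum>k\<le>3*n. monom (of_nat (3*n choose k)) (2*k div 3))"

lemma coeff_floor_binom_poly:
  "coeff (floor_binom_poly n) m = (\<Sum>k | k \<le> 3*n \<and> 2*k div 3 = m. of_nat (3*n choose k))"
  by (simp add: floor_binom_poly_def coeff_sum flip: sum.inter_filter)

lemma poly_floor_binom_poly:
  "poly (floor_binom_poly n) z = (\<Sum>k\<le>3*n. of_nat (3*n choose k) * z ^ (2*k div 3))"
  by (simp add: floor_binom_poly_def poly_sum poly_monom)

text \<open>Passing to the law of \<open>X\<close> makes the integral a finite sum, and every weight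
  has the denominator \<open>2 ^ (3*n) = 8 ^ n\<close>, so both sides have the same roots.\<close>

lemma pgf_floor_binomial:
  assumes "X \<in> measurable M (count_space UNIV)"
    and "distr M (count_space UNIV) X = measure_pmf (binomial_pmf (3*n) (1/2))"
  shows "pgf M (\<lambda>\<omega>. nat \<lfloor>2 * real (X \<omega>) / 3\<rfloor>) z = poly (floor_binom_poly n) z / 8 ^ n"
proof -
  have floor_eq: "nat \<lfloor>2 * real k / 3\<rfloor> = 2 * k div 3" for k
    using floor_divide_of_nat_eq[of "2*k" 3, where 'a = real] by simp
  have "pgf M (\<lambda>\<omega>. nat \<lfloor>2 * real (X \<omega>) / 3\<rfloor>) z = (LINT \<omega>|M. z ^ (2 * X \<omega> div 3))"
    by (simp add: pgf_def floor_eq)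
  also have "\<dots> = (LINT k|distr M (count_space UNIV) X. z ^ (2 * k div 3))"
    by (subst integral_distr[OF assms(1)]) auto
  also have "\<dots> = (\<Sum>k\<le>3*n. pmf (binomial_pmf (3*n) (1/2)) k *\<^sub>R z ^ (2 * k div 3))"
    unfolding assms(2) by (rule integral_measure_pmf) (auto simp: set_pmf_binomial_eq)
  also have "\<dots> = (\<Sum>k\<le>3*n. of_nat (3*n choose k) * z ^ (2*k div 3) / 8 ^ n)"
  proof (rule sum.cong[OF refl])
    fix k assume "k \<in> {..3*n}"
    then have "pmf (binomial_pmf (3*n) (1/2)) k = real (3*n choose k) / 2 ^ (3*n)"
      by (simp add: power_one_over field_simps flip: power_add)
    then show "pmf (binomial_pmf (3*n) (1/2)) k *\<^sub>R z ^ (2 * k div 3) =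
        of_nat (3*n choose k) * z ^ (2*k div 3) / 8 ^ n"
      by (simp add: scaleR_conv_of_real power_mult)
  qed
  finally show ?thesis
    by (simp add: poly_floor_binom_poly sum_divide_distrib)
qed

lemma degree_floor_binom_poly: "degree (floor_binom_poly n) = 2*n"
  and lead_coeff_floor_binom_poly: "coeff (floor_binom_poly n) (2*n) = 1"
proof -
  have "{k. k \<le> 3*n \<and> 2*k div 3 = 2*n} = {3*n}"
    by auto
  then show lc: "coeff (floor_binom_poly n) (2*n) = 1"
    by (simp add: coeff_floor_binom_poly)
  have "coeff (floor_binom_poly n) m = 0" if "m > 2*n" for m
  proof -
    have "{k. k \<le> 3*n \<and> 2*k div 3 = m} = {}"
      using that by auto
    then show ?thesis by (simp only: coeff_floor_binom_poly sum.empty)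
  qed
  then have "degree (floor_binom_poly n) \<le> 2*n"
    by (intro degree_le) auto
  with lc show "degree (floor_binom_poly n) = 2*n"
    by (simp add: le_degree order_antisym)
qed

text \<open>Exponents 1 mod 3 apart matter here: just below the top, only \<open>k = 3*n - 1\<close>
  is sent to \<open>2*n - 1\<close>.\<close>

lemma coeff_floor_binom_poly_1:
  assumes "n \<ge> 1"
  shows "coeff (floor_binom_poly n) (2*n - 1) = of_nat (3*n)"
proof -
  have "{k. k \<le> 3*n \<and> 2*k div 3 = 2*n - 1} = {3*n - 1}"
    using assms by auto
  moreover have "3*n choose (3*n - 1) = 3*n"
    using assms by (subst binomial_symmetric) auto
  ultimately show ?thesis
    by (simp add: coeff_floor_binom_poly)
qed

text \<open>Here rounding merges two values of \<open>k\<close>, and Pascal's rule adds their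
  binomial coefficients.\<close>

lemma coeff_floor_binom_poly_2:
  assumes "n \<ge> 1"
  shows "coeff (floor_binom_poly n) (2*n - 2) = of_nat ((3*n + 1) choose 3)"
proof -
  have "{k. k \<le> 3*n \<and> 2*k div 3 = 2*n - 2} = {3*n - 3, 3*n - 2}"
    using assms by auto
  moreover have "3*n choose (3*n - 3) = 3*n choose 3" "3*n choose (3*n - 2) = 3*n choose 2"
    using assms by (subst binomial_symmetric; simp)+
  moreover have "(3*n + 1) choose 3 = (3*n choose 2) + (3*n choose 3)"
    by (simp add: numeral_3_eq_3 numeral_2_eq_2)
  moreover have "3*n - 3 \<noteq> 3*n - 2"
    using assms by auto
  ultimately show ?thesis
    by (simp add: coeff_floor_binom_poly)
qed

lemma six_times_choose_3: "6 * real ((m + 1) choose 3) = (real m + 1) * real m * (real m - 1)"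
proof (induction m)
  case (Suc m)
  have "2 * (Suc m choose 2) = Suc m * m"
    by (simp add: choose_two)
  then have "2 * real (Suc m choose 2) = (real m + 1) * real m"
    by (metis of_nat_Suc of_nat_mult of_nat_numeral add.commute)
  moreover have "(Suc m + 1) choose 3 = (Suc m choose 2) + (Suc m choose 3)"
    by (simp add: numeral_3_eq_3 numeral_2_eq_2)
  ultimately show ?case
    using Suc by (simp add: algebra_simps)
qed simp

lemma reflect_poly_prod_mset:
  fixes A :: "'a::{comm_semiring_1,semiring_no_zero_divisors} poly multiset"
  shows "reflect_poly (prod_mset A) = prod_mset (image_mset reflect_poly A)"
  by (induction A) (simp_all add: reflect_poly_mult)

text \<open>Newton's identity in degree two. With the factors reversed, the relevant coefficients
  have the fixed indices 0, 1, 2, whatever the size of \<open>A\<close>, so induction can add one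
  factor at a time.\<close>

lemma coeff_prod_linear_factors:
  fixes A :: "'a::comm_ring_1 multiset"
  defines "Q \<equiv> (\<Prod>x\<in>#A. [:1, -x:])"
  shows "coeff Q 0 = 1" "coeff Q 1 = - sum_mset A"
    "2 * coeff Q 2 = (sum_mset A)\<^sup>2 - (\<Sum>x\<in>#A. x\<^sup>2)"
  unfolding Q_def
proof (induction A)
  case (add x A)
  { case 1 show ?case using add by simp
  next case 2 show ?case using add by (simp add: coeff_pCons)
  next case 3 show ?case using add
      by (simp add: coeff_pCons numeral_2_eq_2 algebra_simps power2_eq_square) }
qed simp_all

text \<open>Reflecting \<open>p\<close> moves its top three coefficients to the bottom, where
  Newton's identity applies.\<close>

lemma sum_squares_roots:
  fixes p :: "'a::{idom,ring_char_0} poly"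
  assumes p: "p = (\<Prod>x\<in>#A. [:-x, 1:])" and "degree p \<ge> 2"
  shows "(\<Sum>x\<in>#A. x\<^sup>2) = (coeff p (degree p - 1))\<^sup>2 - 2 * coeff p (degree p - 2)"
proof -
  have "reflect_poly [:-x, 1:] = [:1, -x:]" for x :: 'a
    by (rule poly_eqI) (auto simp: coeff_reflect_poly coeff_pCons split: nat.splits)
  then have "reflect_poly p = (\<Prod>x\<in>#A. [:1, -x:])"
    by (simp add: p reflect_poly_prod_mset image_mset.compositionality comp_def)
  then have "coeff p (degree p - 1) = - sum_mset A"
    "2 * coeff p (degree p - 2) = (sum_mset A)\<^sup>2 - (\<Sum>x\<in>#A. x\<^sup>2)"
    using coeff_prod_linear_factors[of A] assms(2)
    by (simp_all add: coeff_reflect_poly flip: \<open>reflect_poly p = _\<close>)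
  then show ?thesis by simp
qed

lemma root_with_large_Im:
  assumes "n \<ge> 1"
  obtains z where "poly (floor_binom_poly n) z = 0"
    "(Im z)\<^sup>2 \<ge> (9 * (real n)\<^sup>2 - 9 * real n - 1) / 2"
proof -
  define p where "p = floor_binom_poly n"
  define a where "a = (9 * (real n)\<^sup>2 - 9 * real n - 1) / 2"
  have deg: "degree p = 2*n" and lc: "lead_coeff p = 1"
    by (simp_all add: p_def degree_floor_binom_poly lead_coeff_floor_binom_poly)
  then have "p \<noteq> 0" by auto
  \<comment> \<open>A multiset records multiplicities, so the average is over exactly
    \<open>2*n\<close> roots.\<close>
  then obtain A where A: "size A = degree p" "p = smult (lead_coeff p) (\<Prod>x\<in>#A. [:-x, 1:])"
    using alg_closed_imp_factorization by blast
  then have pA: "p = (\<Prod>x\<in>#A. [:-x, 1:])"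
    using lc by simp
  have "(\<Sum>x\<in>#A. x\<^sup>2) = (of_nat (3*n))\<^sup>2 - 2 * of_nat ((3*n + 1) choose 3)"
    using sum_squares_roots[OF pA] assms coeff_floor_binom_poly_1[OF assms]
      coeff_floor_binom_poly_2[OF assms]
    by (simp add: deg flip: p_def)
  also have "\<dots> = of_real ((real (3*n))\<^sup>2 - 2 * real ((3*n + 1) choose 3))"
    by simp
  \<comment> \<open>The binomial term is \<open>(3*n + 1) * n * (3*n - 1)\<close>, that is
    \<open>n * (9*n^2 - 1)\<close>.\<close>
  also have "(real (3*n))\<^sup>2 - 2 * real ((3*n + 1) choose 3) = - real (2*n) * a"
    using six_times_choose_3[of "3*n"] by (simp add: a_def algebra_simps power2_eq_square)
  finally have "Re (\<Sum>x\<in>#A. x\<^sup>2) = - real (2*n) * a"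
    by simp
  moreover have "Re (\<Sum>x\<in>#B. x\<^sup>2) \<ge> - (\<Sum>x\<in>#B. (Im x)\<^sup>2)" for B :: "complex multiset"
  proof (induction B)
    case (add x B)
    have "Re (x\<^sup>2) \<ge> - (Im x)\<^sup>2"
      by (simp add: Re_power2)
    with add show ?case by simp
  qed simp
  ultimately have *: "real (size A) * a \<le> (\<Sum>x\<in>#A. (Im x)\<^sup>2)"
    using A(1) deg by (metis mult_minus_left neg_le_iff_le)
  have "\<exists>z\<in>#A. (Im z)\<^sup>2 \<ge> a"
  proof (rule ccontr)
    assume contra: "\<not> ?thesis"
    \<comment> \<open>Strictness needs a nonempty multiset; the singleton is the effective base
      case.\<close>
    have "(\<Sum>x\<in>#B. (Im x)\<^sup>2) < real (size B) * a"
      if "B \<noteq> {#}" "\<forall>x\<in>#B. (Im x)\<^sup>2 < a" for B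
      using that
    proof (induction B)
      case (add x B)
      then show ?case by (cases "B = {#}") (auto simp: algebra_simps)
    qed simp
    moreover have "A \<noteq> {#}" using A(1) deg assms by auto
    ultimately show False using contra * by force
  qed
  then obtain z where z: "z \<in># A" "(Im z)\<^sup>2 \<ge> a" by blast
  then have "poly p z = 0"
    by (auto simp: pA poly_prod_mset prod_mset_zero_iff)
  with z that show ?thesis by (simp add: p_def a_def)
qed

text \<open>The coefficients are natural numbers, hence fixed by conjugation.\<close>

lemma poly_floor_binom_poly_cnj:
  "poly (floor_binom_poly n) (cnj z) = cnj (poly (floor_binom_poly n) z)"
  by (simp add: poly_floor_binom_poly)

theorem theorem4p4:
  fixes n :: nat and M :: "'a measure" and X :: "'a \<Rightarrow> nat"
  assumes "n \<ge> 1"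
    and "prob_space M"
    and "X \<in> measurable M (count_space UNIV)"
    and "distr M (count_space UNIV) X = measure_pmf (binomial_pmf (3 * n) (1/2))"
  shows "Max {Im z | z. pgf M (\<lambda>\<omega>. nat \<lfloor>2 * real (X \<omega>) / 3\<rfloor>) z = 0}
           \<ge> sqrt ((9 * (real n)\<^sup>2 - 9 * real n - 1) / 2)"
proof -
  define p where "p = floor_binom_poly n"
  have roots: "{Im z | z. pgf M (\<lambda>\<omega>. nat \<lfloor>2 * real (X \<omega>) / 3\<rfloor>) z = 0} = Im ` {z. poly p z = 0}"
    using pgf_floor_binomial[OF assms(3,4)] by (auto simp: p_def)
  have "p \<noteq> 0"
    using lead_coeff_floor_binom_poly[of n] by (auto simp: p_def)
  \<comment> \<open>Finiteness ensures that \<open>Max\<close> is a genuine maximum.\<close>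
  then have fin: "finite (Im ` {z. poly p z = 0})"
    by (simp add: poly_roots_finite)
  obtain z where z: "poly p z = 0" "(Im z)\<^sup>2 \<ge> (9 * (real n)\<^sup>2 - 9 * real n - 1) / 2"
    using root_with_large_Im[OF assms(1)] unfolding p_def by metis
  have "\<bar>Im z\<bar> \<in> Im ` {z. poly p z = 0}"
  proof (cases "Im z \<ge> 0")
    case False
    then have "\<bar>Im z\<bar> = Im (cnj z)" by simp
    moreover have "poly p (cnj z) = 0"
      using z(1) poly_floor_binom_poly_cnj by (simp add: p_def)
    ultimately show ?thesis by blast
  qed (use z(1) in auto)
  \<comment> \<open>For \<open>n = 1\<close> the radicand is negative; \<open>sqrt\<close> is then
    negative too and still monotone on all reals.\<close>
  moreover have "sqrt ((9 * (real n)\<^sup>2 - 9 * real n - 1) / 2) \<le> \<bar>Im z\<bar>"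
    using real_sqrt_le_mono[OF z(2)] by simp
  ultimately show ?thesis
    unfolding roots using Max_ge[OF fin] order_trans by blast
qed

end
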